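(* Let $f,g:\mathbb{H}\to\mathbb{H}$ be functions that have right GHR derivatives. Then their product $fg$ (defined by $(fg)(q)=f(q)g(q)$) also has right GHR derivatives, and for every $\mu\in\mathbb{H}$, $\mu\neq 0$, $$\frac{\partial_r (fg)}{\partial q^{\mu}}=\frac{\partial_r f}{\partial q^{\mu}}\,g+f\,\frac{\partial_r g}{\partial q^{f^*\mu}},\qquad \frac{\partial_r (fg)}{\partial q^{\mu*}}=\frac{\partial_r f}{\partial q^{\mu*}}\,g+f\,\frac{\partial_r g}{\partial q^{f^*\mu*}},$$ where, at a point $q$, $\frac{\partial_r g}{\partial q^{f^*\mu}}$ and $\frac{\partial_r g}{\partial q^{f^*\mu*}}$ denote the right GHR derivatives of $g$ at $q$ obtained by replacing $\mu$ with the quaternion $f(q)^*\mu$ in the definition of $\frac{\partial_r g}{\partial q^{\mu}}$ and $\frac{\partial_r g}{\partial q^{\mu*}}$; at points with $f(q)=0$ the terms $f\frac{\partial_r g}{\partial q^{f^*\mu}}$ and $f\frac{\partial_r g}{\partial q^{f^*\mu*}}$ are read as $0$.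
   Context: $\mathbb{H}$ denotes the real quaternions $q=q_a+iq_b+jq_c+kq_d$ with $q_a,q_b,q_c,q_d\in\mathbb{R}$ and $i^2=j^2=k^2=ijk=-1$. The conjugate is $q^*=q_a-iq_b-jq_c-kq_d$. For $\mu\in\mathbb{H}$, $\mu\ne0$, and $p\in\mathbb{H}$, write $p^{\mu}:=\mu p\mu^{-1}$ and $p^{\mu*}:=(p^{\mu})^*$; a product in the exponent, such as $p^{\nu\mu}$, means rotation by the quaternion product $\nu\mu$, and $p^{\nu\mu*}=(p^{\nu\mu})^*$. An $\mathbb{H}$-valued function $f$ is regarded as a function of the four real variables $q_a,q_b,q_c,q_d$, and $\frac{\partial f}{\partial q_a},\dots,\frac{\partial f}{\partial q_d}$ are its ($\mathbb{H}$-valued, componentwise) partial derivatives; $f$ has right GHR derivatives when these partial derivatives exist. For $\mu\neq0$ the right GHR derivatives of $f$ are $$\frac{\partial_r f}{\partial q^{\mu}}=\frac14\left(\frac{\partial f}{\partial q_a}-i^{\mu}\frac{\partial f}{\partial q_b}-j^{\mu}\frac{\partial f}{\partial q_c}-k^{\mu}\frac{\partial f}{\partial q_d}\right),\qquad \frac{\partial_r f}{\partial q^{\mu*}}=\frac14\left(\frac{\partial f}{\partial q_a}+i^{\mu}\frac{\partial f}{\partial q_b}+j^{\mu}\frac{\partial f}{\partial q_c}+k^{\mu}\frac{\partial f}{\partial q_d}\right).$$ *)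

theory Defs
  imports "HOL-Analysis.Analysis"
begin

datatype quat = Quat (qa: real) (qb: real) (qc: real) (qd: real)

lemma quat_eq_iff: "p = q \<longleftrightarrow> qa p = qa q \<and> qb p = qb q \<and> qc p = qc q \<and> qd p = qd q"
  by (cases p; cases q) simp

instantiation quat :: "{ring_1, inverse, scaleR}"
begin

definition zero_quat :: quat where "0 = Quat 0 0 0 0"

definition one_quat :: quat where "1 = Quat 1 0 0 0"

definition plus_quat :: "quat \<Rightarrow> quat \<Rightarrow> quat" where
  "p + q = Quat (qa p + qa q) (qb p + qb q) (qc p + qc q) (qd p + qd q)"

definition uminus_quat :: "quat \<Rightarrow> quat" where
  "- q = Quat (- qa q) (- qb q) (- qc q) (- qd q)"

definition minus_quat :: "quat \<Rightarrow> quat \<Rightarrow> quat" where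
  "p - q = Quat (qa p - qa q) (qb p - qb q) (qc p - qc q) (qd p - qd q)"

text \<open>The Hamilton product; the relations between the units are derived below.\<close>
definition times_quat :: "quat \<Rightarrow> quat \<Rightarrow> quat" where
  "p * q = Quat
     (qa p * qa q - qb p * qb q - qc p * qc q - qd p * qd q)
     (qa p * qb q + qb p * qa q + qc p * qd q - qd p * qc q)
     (qa p * qc q - qb p * qd q + qc p * qa q + qd p * qb q)
     (qa p * qd q + qb p * qc q - qc p * qb q + qd p * qa q)"

definition scaleR_quat :: "real \<Rightarrow> quat \<Rightarrow> quat" where
  "scaleR r q = Quat (r * qa q) (r * qb q) (r * qc q) (r * qd q)"

definition inverse_quat :: "quat \<Rightarrow> quat" where
  "inverse q = scaleR (1 / ((qa q)\<^sup>2 + (qb q)\<^sup>2 + (qc q)\<^sup>2 + (qd q)\<^sup>2))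
     (Quat (qa q) (- qb q) (- qc q) (- qd q))"

definition divide_quat :: "quat \<Rightarrow> quat \<Rightarrow> quat" where
  "divide_quat p q = p * inverse q"

instance
  by intro_classes
    (simp_all add: quat_eq_iff zero_quat_def one_quat_def plus_quat_def uminus_quat_def
      minus_quat_def times_quat_def algebra_simps)

end

lemma quat_zero_sel [simp]: "qa 0 = 0" "qb 0 = 0" "qc 0 = 0" "qd 0 = 0"
  by (simp_all add: zero_quat_def)

lemma quat_one_sel [simp]: "qa 1 = 1" "qb 1 = 0" "qc 1 = 0" "qd 1 = 0"
  by (simp_all add: one_quat_def)

lemma quat_add_sel [simp]:
  "qa (p + q) = qa p + qa q" "qb (p + q) = qb p + qb q"
  "qc (p + q) = qc p + qc q" "qd (p + q) = qd p + qd q"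
  by (simp_all add: plus_quat_def)

lemma quat_uminus_sel [simp]:
  "qa (- q) = - qa q" "qb (- q) = - qb q" "qc (- q) = - qc q" "qd (- q) = - qd q"
  by (simp_all add: uminus_quat_def)

lemma quat_diff_sel [simp]:
  "qa (p - q) = qa p - qa q" "qb (p - q) = qb p - qb q"
  "qc (p - q) = qc p - qc q" "qd (p - q) = qd p - qd q"
  by (simp_all add: minus_quat_def)

lemma quat_mult_sel [simp]:
  "qa (p * q) = qa p * qa q - qb p * qb q - qc p * qc q - qd p * qd q"
  "qb (p * q) = qa p * qb q + qb p * qa q + qc p * qd q - qd p * qc q"
  "qc (p * q) = qa p * qc q - qb p * qd q + qc p * qa q + qd p * qb q"
  "qd (p * q) = qa p * qd q + qb p * qc q - qc p * qb q + qd p * qa q"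
  by (simp_all add: times_quat_def)

lemma quat_scaleR_sel [simp]:
  "qa (r *\<^sub>R q) = r * qa q" "qb (r *\<^sub>R q) = r * qb q"
  "qc (r *\<^sub>R q) = r * qc q" "qd (r *\<^sub>R q) = r * qd q"
  by (simp_all add: scaleR_quat_def)

lemma quat_sum_squares_eq_0:
  "(qa q)\<^sup>2 + (qb q)\<^sup>2 + (qc q)\<^sup>2 + (qd q)\<^sup>2 = 0 \<longleftrightarrow> q = 0"
  by (auto simp: quat_eq_iff add_nonneg_eq_0_iff)

instance quat :: real_div_algebra
proof
  fix q :: quat
  let ?N = "(qa q)\<^sup>2 + (qb q)\<^sup>2 + (qc q)\<^sup>2 + (qd q)\<^sup>2"
  assume "q \<noteq> 0"
  then have N: "?N \<noteq> 0"
    using quat_sum_squares_eq_0 by blast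
  have eq: "1 / ?N * qa q * qa q + 1 / ?N * qb q * qb q + 1 / ?N * qc q * qc q + 1 / ?N * qd q * qd q = 1"
  proof -
    have "1 / ?N * qa q * qa q + 1 / ?N * qb q * qb q + 1 / ?N * qc q * qc q + 1 / ?N * qd q * qd q
        = 1 / ?N * ?N"
      by (simp only: power2_eq_square distrib_left mult.assoc)
    then show ?thesis using N by simp
  qed
  show "inverse q * q = 1" "q * inverse q = 1"
    using eq by (simp_all add: quat_eq_iff inverse_quat_def mult.assoc mult.left_commute mult.commute)
next
  show "inverse (0 :: quat) = 0"
    by (simp add: quat_eq_iff inverse_quat_def)
qed (simp_all add: quat_eq_iff divide_quat_def algebra_simps)

definition qi :: quat where "qi = Quat 0 1 0 0"
definition qj :: quat where "qj = Quat 0 0 1 0"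
definition qk :: quat where "qk = Quat 0 0 0 1"

lemma quat_units:
  "qi * qi = -1" "qj * qj = -1" "qk * qk = -1" "qi * qj * qk = -1"
  by (simp_all add: quat_eq_iff qi_def qj_def qk_def)

lemma quat_expand: "q = qa q *\<^sub>R 1 + qb q *\<^sub>R qi + qc q *\<^sub>R qj + qd q *\<^sub>R qk"
  by (simp add: quat_eq_iff qi_def qj_def qk_def)

definition qcnj :: "quat \<Rightarrow> quat" where
  "qcnj q = Quat (qa q) (- qb q) (- qc q) (- qd q)"

definition qrot :: "quat \<Rightarrow> quat \<Rightarrow> quat" where
  "qrot \<mu> p = \<mu> * p * inverse \<mu>"

text \<open>For \<open>e\<close> one of \<open>1, qi, qj, qk\<close>, this is the partial derivative at \<open>q\<close> with respect to the
  real variable \<open>q\<^sub>a, q\<^sub>b, q\<^sub>c, q\<^sub>d\<close>, taken in each of the four components of \<open>f\<close>.\<close>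
definition qpartial :: "quat \<Rightarrow> (quat \<Rightarrow> quat) \<Rightarrow> quat \<Rightarrow> quat" where
  "qpartial e f q = Quat
     (deriv (\<lambda>t::real. qa (f (q + t *\<^sub>R e))) 0)
     (deriv (\<lambda>t::real. qb (f (q + t *\<^sub>R e))) 0)
     (deriv (\<lambda>t::real. qc (f (q + t *\<^sub>R e))) 0)
     (deriv (\<lambda>t::real. qd (f (q + t *\<^sub>R e))) 0)"

text \<open>All partial derivatives exist at every point; total differentiability is not required.\<close>
definition has_right_GHR :: "(quat \<Rightarrow> quat) \<Rightarrow> bool" where
  "has_right_GHR f \<longleftrightarrow>
     (\<forall>q. \<forall>e \<in> {1, qi, qj, qk}. \<forall>c \<in> {qa, qb, qc, qd}.
        (\<lambda>t::real. c (f (q + t *\<^sub>R e))) differentiable (at 0))"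

text \<open>The right GHR derivatives of \<open>f\<close> at \<open>q\<close> with respect to \<open>q\<^sup>\<mu>\<close> and to \<open>q\<^sup>\<mu>\<^sup>*\<close>;
  they are meaningful for \<open>\<mu> \<noteq> 0\<close>.\<close>
definition right_GHR :: "quat \<Rightarrow> (quat \<Rightarrow> quat) \<Rightarrow> quat \<Rightarrow> quat" where
  "right_GHR \<mu> f q = (1/4) *\<^sub>R
     (qpartial 1 f q - qrot \<mu> qi * qpartial qi f q
        - qrot \<mu> qj * qpartial qj f q - qrot \<mu> qk * qpartial qk f q)"

definition right_GHR_cnj :: "quat \<Rightarrow> (quat \<Rightarrow> quat) \<Rightarrow> quat \<Rightarrow> quat" where
  "right_GHR_cnj \<mu> f q = (1/4) *\<^sub>R
     (qpartial 1 f q + qrot \<mu> qi * qpartial qi f q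
        + qrot \<mu> qj * qpartial qj f q + qrot \<mu> qk * qpartial qk f q)"

end

theory Submission
  imports Defs
begin

text \<open>The first-order operators \<open>right_GHR \<mu>\<close> and \<open>right_GHR_cnj \<mu>\<close> are real linear combinations
  of the four partial derivatives, each multiplied \<^emph>\<open>from the left\<close> by a rotated unit. Partial
  derivatives obey the Leibniz rule with the order of the factors kept, because the Hamilton product
  is bilinear, so they turn the product \<open>f g\<close> into \<open>(\<partial>f) g + f (\<partial>g)\<close>. The first part gives the
  derivative of \<open>f\<close> times \<open>g\<close> at once. In the second part a rotated unit stands to the left of \<open>f\<close>,
  whereas the derivative of \<open>g\<close> needs its units to the right of \<open>f\<close>. Moving \<open>f\<close> past the unit
  changes the rotation: \<open>qrot \<mu> p * f = f * qrot (qcnj f * \<mu>) p\<close> for \<open>f \<noteq> 0\<close>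
  (\<open>qrot_mult_swap\<close>). This is exactly the change of \<open>\<mu>\<close> in the product rule. Where \<open>f = 0\<close> the
  second part vanishes.\<close>

text \<open>Every \<open>x\<close> satisfies \<open>x * w = w * qrot (inverse w) x\<close>, and \<open>inverse w\<close> and \<open>qcnj w\<close> differ
  only by the positive real factor \<open>w * qcnj w\<close>, which cancels in a rotation.\<close>
lemma qrot_mult_swap:
  assumes "w \<noteq> 0" and "\<mu> \<noteq> 0"
  shows "qrot \<mu> p * w = w * qrot (qcnj w * \<mu>) p"
proof -
  define N where "N = (qa w)\<^sup>2 + (qb w)\<^sup>2 + (qc w)\<^sup>2 + (qd w)\<^sup>2"
  have N: "w * qcnj w = N *\<^sub>R 1"
    by (simp add: quat_eq_iff qcnj_def N_def power2_eq_square)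
  have nz: "qcnj w \<noteq> 0"
    using assms(1) by (auto simp: quat_eq_iff qcnj_def)
  have "w * (qcnj w * inverse (qcnj w)) = N *\<^sub>R inverse (qcnj w)"
    by (simp only: mult.assoc[symmetric] N) simp
  then have w: "N *\<^sub>R inverse (qcnj w) = w"
    using nz by simp
  have "w * qrot (qcnj w * \<mu>) p = (w * qcnj w) * (\<mu> * p * inverse \<mu> * inverse (qcnj w))"
    using nz assms(2) by (simp add: qrot_def nonzero_inverse_mult_distrib mult.assoc)
  also have "\<dots> = \<mu> * p * inverse \<mu> * (N *\<^sub>R inverse (qcnj w))"
    by (simp add: N)
  also have "\<dots> = qrot \<mu> p * w"
    by (simp add: w qrot_def)
  finally show ?thesis ..
qed

text \<open>Only the restriction of the functions to the line through \<open>q\<close> in direction \<open>e\<close> matters, so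
  the existence of the partial derivatives in this one direction suffices for the Leibniz rule.
  Componentwise it is the real product rule applied to the four terms of each Hamilton component.\<close>
lemma
  fixes e q :: quat
  assumes f: "\<forall>c \<in> {qa, qb, qc, qd}. (\<lambda>t::real. c (f (q + t *\<^sub>R e))) differentiable (at 0)"
    and g: "\<forall>c \<in> {qa, qb, qc, qd}. (\<lambda>t::real. c (g (q + t *\<^sub>R e))) differentiable (at 0)"
  shows qpartial_mult:
      "qpartial e (\<lambda>q. f q * g q) q = qpartial e f q * g q + f q * qpartial e g q"
    and differentiable_components_mult:
      "\<forall>c \<in> {qa, qb, qc, qd}.
         (\<lambda>t::real. c (f (q + t *\<^sub>R e) * g (q + t *\<^sub>R e))) differentiable (at 0)"
proof -
  have DERIV_f: "((\<lambda>t. c (f (q + t *\<^sub>R e))) has_field_derivative c (qpartial e f q)) (at 0)"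
    if "c \<in> {qa, qb, qc, qd}" for c
    using f that by (auto simp: qpartial_def DERIV_deriv_iff_real_differentiable)
  have DERIV_g: "((\<lambda>t. c (g (q + t *\<^sub>R e))) has_field_derivative c (qpartial e g q)) (at 0)"
    if "c \<in> {qa, qb, qc, qd}" for c
    using g that by (auto simp: qpartial_def DERIV_deriv_iff_real_differentiable)
  have DERIV_fg: "((\<lambda>t. c (f (q + t *\<^sub>R e) * g (q + t *\<^sub>R e))) has_field_derivative
      c (qpartial e f q * g q + f q * qpartial e g q)) (at 0)" if "c \<in> {qa, qb, qc, qd}" for c
    using that
    by (auto intro!: derivative_eq_intros DERIV_f DERIV_g simp: algebra_simps)
  show "qpartial e (\<lambda>q. f q * g q) q = qpartial e f q * g q + f q * qpartial e g q"
    using DERIV_fg[THEN DERIV_imp_deriv]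
    by (simp add: quat_eq_iff qpartial_def[of e "\<lambda>q. f q * g q" q]
        del: quat_mult_sel quat_add_sel)
  show "\<forall>c \<in> {qa, qb, qc, qd}.
      (\<lambda>t::real. c (f (q + t *\<^sub>R e) * g (q + t *\<^sub>R e))) differentiable (at 0)"
    using DERIV_fg real_differentiable_def by blast
qed

theorem theorem3p4:
  fixes f g :: "quat \<Rightarrow> quat"
  assumes "has_right_GHR f" and "has_right_GHR g"
  shows "has_right_GHR (\<lambda>q. f q * g q) \<and>
    (\<forall>\<mu> q. \<mu> \<noteq> 0 \<longrightarrow>
       right_GHR \<mu> (\<lambda>q. f q * g q) q =
         right_GHR \<mu> f q * g q
           + (if f q = 0 then 0 else f q * right_GHR (qcnj (f q) * \<mu>) g q) \<and>
       right_GHR_cnj \<mu> (\<lambda>q. f q * g q) q =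
         right_GHR_cnj \<mu> f q * g q
           + (if f q = 0 then 0 else f q * right_GHR_cnj (qcnj (f q) * \<mu>) g q))"
proof (intro conjI allI impI)
  show "has_right_GHR (\<lambda>q. f q * g q)"
    unfolding has_right_GHR_def
  proof (intro allI ballI)
    fix q e c
    assume "e \<in> {1, qi, qj, qk}" and c: "c \<in> {qa, qb, qc, qd}"
    then show "(\<lambda>t::real. c (f (q + t *\<^sub>R e) * g (q + t *\<^sub>R e))) differentiable (at 0)"
      using assms unfolding has_right_GHR_def
      by (intro differentiable_components_mult[THEN bspec, OF _ _ c]) blast+
  qed
next
  fix \<mu> q :: quat
  assume \<mu>: "\<mu> \<noteq> 0"
  have leibniz: "qpartial e (\<lambda>q. f q * g q) q = qpartial e f q * g q + f q * qpartial e g q"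
    if "e \<in> {1, qi, qj, qk}" for e
    using that assms unfolding has_right_GHR_def by (intro qpartial_mult) blast+
  have swap: "qrot \<mu> p * (f q * x) = f q * (qrot (qcnj (f q) * \<mu>) p * x)" if "f q \<noteq> 0" for p x
    using qrot_mult_swap[OF that \<mu>] by (simp add: mult.assoc[symmetric])
  show "right_GHR \<mu> (\<lambda>q. f q * g q) q =
      right_GHR \<mu> f q * g q
        + (if f q = 0 then 0 else f q * right_GHR (qcnj (f q) * \<mu>) g q)"
    by (cases "f q = 0")
      (simp_all add: right_GHR_def leibniz swap distrib_left distrib_right
        left_diff_distrib right_diff_distrib scaleR_add_right scaleR_diff_right mult.assoc)
  show "right_GHR_cnj \<mu> (\<lambda>q. f q * g q) q =
      right_GHR_cnj \<mu> f q * g q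
        + (if f q = 0 then 0 else f q * right_GHR_cnj (qcnj (f q) * \<mu>) g q)"
    by (cases "f q = 0")
      (simp_all add: right_GHR_cnj_def leibniz swap distrib_left distrib_right
        scaleR_add_right mult.assoc)
qed

end
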